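(* Let $p$ be an odd prime, let $n\geq 3$ be an integer, and let $G$ be a group of order $p^n$ such that $\exp(G)\neq p$. If $\Omega_1(G)\neq G$, then $$\alpha(G)\leq \frac{2p^{n-2}+p^{n-3}+\ldots+p+2}{p^n},$$ and equality holds if and only if $\exp(G)=p^2$ and $\Omega_{\{1\}}(G)=\Omega_1(G)$ is of index $p$ in $G$ (that is, the set $\Omega_{\{1\}}(G)$ coincides with the subgroup $\Omega_1(G)$, and this subgroup has index $p$ in $G$).
   Context: For a finite group $G$, $C(G)$ denotes the set of cyclic subgroups of $G$ (including the trivial subgroup), and $\alpha(G)=\frac{|C(G)|}{|G|}$. $\exp(G)$ is the exponent of $G$. For a finite $p$-group $G$, $\Omega_{\{1\}}(G)=\{x\in G \mid x^p=1\}$ (a subset of $G$), and $\Omega_1(G)=\langle\Omega_{\{1\}}(G)\rangle$ is the subgroup it generates. The numerator $2p^{n-2}+p^{n-3}+\ldots+p+2$ means $2p^{n-2}+\sum_{i=1}^{n-3}p^i+2$, with the sum empty when $n=3$. *)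

theory Defs
  imports Complex_Main "HOL-Algebra.Algebra"
begin

definition cyclic_subgroups :: "('a, 'b) monoid_scheme \<Rightarrow> 'a set set" where
  "cyclic_subgroups G = {H. subgroup H G \<and> cyclic_group (G\<lparr>carrier := H\<rparr>)}"

definition alpha :: "('a, 'b) monoid_scheme \<Rightarrow> real" where
  "alpha G = real (card (cyclic_subgroups G)) / real (order G)"

(* Meaningful only for groups of finite exponent; in particular for finite groups. *)
definition group_exponent :: "('a, 'b) monoid_scheme \<Rightarrow> nat" where
  "group_exponent G = (LEAST m. 0 < m \<and> (\<forall>x\<in>carrier G. x [^]\<^bsub>G\<^esub> m = \<one>\<^bsub>G\<^esub>))"

(* The prime p is an explicit parameter; for a nontrivial p-group G it is determined by G. *)
definition Omega_set :: "nat \<Rightarrow> ('a, 'b) monoid_scheme \<Rightarrow> 'a set" where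
  "Omega_set p G = {x \<in> carrier G. x [^]\<^bsub>G\<^esub> p = \<one>\<^bsub>G\<^esub>}"

definition Omega_subgroup :: "nat \<Rightarrow> ('a, 'b) monoid_scheme \<Rightarrow> 'a set" where
  "Omega_subgroup p G = generate G (Omega_set p G)"

definition subgroup_index :: "('a, 'b) monoid_scheme \<Rightarrow> 'a set \<Rightarrow> nat" where
  "subgroup_index G H = card (rcosets\<^bsub>G\<^esub> H)"

end

theory Submission
  imports Defs "HOL-Number_Theory.Totient"
begin

text \<open>
  A cyclic group of order \<open>d\<close> has \<open>totient d\<close> generators, so giving each element \<open>x\<close> the weight
  \<open>1 / totient (ord x)\<close> makes the generators of any cyclic subgroup weigh \<open>1\<close> in total:
  the number of cyclic subgroups of a finite group is the sum of these weights
  (\<open>card_cyclic_subgroups\<close>).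

  In a \<open>p\<close>-group the weight is \<open>1\<close> at the identity, \<open>1 / (p - 1)\<close> at an element of order \<open>p\<close>, and
  at most \<open>1 / (p * (p - 1))\<close> at every other element, with equality there exactly for order
  \<open>p\<^sup>2\<close>. Let \<open>N\<close> be the number of solutions of \<open>x\<^sup>p = 1\<close>. Adding up the weights yields
  \<open>p * (p - 1) * |C(G)| \<le> p ^ n + (p - 1) * N + p * (p - 2)\<close>, with equality
  iff every \<open>x\<close> satisfies \<open>x ^ p\<^sup>2 = 1\<close> (\<open>p_group_card_cyclic_subgroups\<close>).
  The right-hand side increases with \<open>N\<close>. All solutions lie in the proper subgroup \<open>\<Omega>\<^sub>1\<close>, whose
  order is at most \<open>p ^ (n - 1)\<close>, and inserting \<open>N = p ^ (n - 1)\<close> produces the stated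
  bound by a geometric sum. Equality therefore means two things at once: the exponent divides
  \<open>p\<^sup>2\<close> (it then equals \<open>p\<^sup>2\<close>, because the order of an element outside \<open>\<Omega>\<^sub>1\<close> does not
  divide \<open>p\<close>),
  and the solution set already has \<open>p ^ (n - 1)\<close> elements, so that it fills a subgroup of
  index \<open>p\<close>.
\<close>

section \<open>Counting cyclic subgroups by their generators\<close>

lemma (in group) cyclic_subgroups_eq_generate_singletons:
  "cyclic_subgroups G = (\<lambda>x. generate G {x}) ` carrier G"
proof (intro equalityI subsetI)
  fix H assume "H \<in> cyclic_subgroups G"
  then have H: "subgroup H G" and cyc: "cyclic_group (G\<lparr>carrier := H\<rparr>)"
    by (auto simp: cyclic_subgroups_def)
  obtain x where x: "x \<in> H" and "subgroup_generated (G\<lparr>carrier := H\<rparr>) {x} = G\<lparr>carrier := H\<rparr>"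
    using cyc by (auto simp: cyclic_group_def)
  then have "carrier (subgroup_generated (G\<lparr>carrier := H\<rparr>) {x}) = H"
    by simp
  then have "generate (G\<lparr>carrier := H\<rparr>) {x} = H"
    using x by (simp add: carrier_subgroup_generated)
  then have "generate G {x} = H"
    using generate_consistent[of "{x}" H] x H by simp
  then show "H \<in> (\<lambda>x. generate G {x}) ` carrier G"
    using x subgroup.subset[OF H] by blast
next
  fix H assume "H \<in> (\<lambda>x. generate G {x}) ` carrier G"
  then obtain x where x: "x \<in> carrier G" "H = generate G {x}"
    by blast
  then have "subgroup H G" and "G\<lparr>carrier := H\<rparr> = subgroup_generated G {x}"
    by (auto simp: subgroup_generated_def intro: generate_is_subgroup)
  then show "H \<in> cyclic_subgroups G"
    using cyclic_group_generated by (simp add: cyclic_subgroups_def)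
qed

text \<open>
  Since \<open>x ^ k\<close> has order \<open>ord x / gcd (ord x) k\<close>, it generates \<open>\<langle>x\<rangle>\<close> iff \<open>k\<close> is coprime to
  \<open>ord x\<close>, and the exponents in \<open>{1..ord x}\<close> give each power of \<open>x\<close> exactly once.
\<close>
lemma (in group) card_generators_of_cyclic:
  assumes fin: "finite (carrier G)" and x: "x \<in> carrier G"
  shows "card {y \<in> carrier G. generate G {y} = generate G {x}} = totient (ord x)"
proof -
  have "{y \<in> carrier G. generate G {y} = generate G {x}} = (\<lambda>k. x [^] k) ` totatives (ord x)"
  proof (intro equalityI subsetI)
    fix y assume "y \<in> {y \<in> carrier G. generate G {y} = generate G {x}}"
    then have y: "y \<in> carrier G" and eq: "generate G {y} = generate G {x}"
      by auto
    have "y \<in> generate G {x}"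
      using eq generate.incl[of y "{y}" G] by simp
    then obtain j where "y = x [^] (j::nat)"
      using generate_pow_on_finite_carrier[OF fin x] by auto
    \<comment> \<open>The residue of \<open>j\<close> in \<open>{1..ord x}\<close>, the range in which totatives live.\<close>
    define k where "k = (if j mod ord x = 0 then ord x else j mod ord x)"
    have "ord x \<ge> 1"
      by (rule ord_ge_1[OF fin x])
    then have k: "0 < k" "k \<le> ord x" and "[int k = int j] (mod int (ord x))"
      by (auto simp: k_def cong_def zmod_int less_imp_le split: if_splits)
    then have "x [^] int k = x [^] int j"
      using int_pow_eq[OF x] by (simp add: cong_iff_dvd_diff dvd_diff_commute)
    then have yk: "y = x [^] k"
      using \<open>y = x [^] j\<close> by (simp add: int_pow_int)
    have "ord y = ord x"
      using generate_pow_card[OF x] generate_pow_card[OF y] eq by simp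
    then have "coprime k (ord x)"
      using pow_ord_eq_ord_iff[OF fin x] yk by simp
    then show "y \<in> (\<lambda>k. x [^] k) ` totatives (ord x)"
      using k yk by (auto simp: totatives_def)
  next
    fix y assume "y \<in> (\<lambda>k. x [^] k) ` totatives (ord x)"
    then obtain k where k: "coprime k (ord x)" and yk: "y = x [^] k"
      by (auto simp: totatives_def)
    have y: "y \<in> carrier G"
      using x yk by simp
    have "generate G {y} \<subseteq> generate G {x}"
      using x yk generate_pow_on_finite_carrier[OF fin x]
      by (intro generate_subgroup_incl generate_is_subgroup) auto
    moreover have "card (generate G {y}) = card (generate G {x})"
      using generate_pow_card[OF x] generate_pow_card[OF y] pow_ord_eq_ord_iff[OF fin x] k yk
      by metis
    moreover have "finite (generate G {x})"
      using fin generate_incl[of "{x}"] x by (simp add: finite_subset)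
    ultimately have "generate G {y} = generate G {x}"
      by (intro card_subset_eq)
    then show "y \<in> {y \<in> carrier G. generate G {y} = generate G {x}}"
      using y by simp
  qed
  moreover have "inj_on (\<lambda>k. x [^] k) (totatives (ord x))"
    by (rule inj_on_subset[OF ord_inj'[OF x]]) (auto simp: totatives_def)
  ultimately show ?thesis
    by (simp add: card_image totient_def)
qed

theorem (in group) card_cyclic_subgroups:
  assumes fin: "finite (carrier G)"
  shows "real (card (cyclic_subgroups G)) = (\<Sum>x\<in>carrier G. 1 / real (totient (ord x)))"
proof -
  let ?C = "\<lambda>x. {y \<in> carrier G. generate G {y} = generate G {x}}"
  have "(\<Sum>x\<in>carrier G. 1 / real (totient (ord x)))
      = (\<Sum>H\<in>(\<lambda>x. generate G {x}) ` carrier G.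
           \<Sum>y\<in>{y \<in> carrier G. generate G {y} = H}. 1 / real (totient (ord y)))"
    by (rule sum.image_gen[OF fin])
  also have "\<dots> = (\<Sum>H\<in>(\<lambda>x. generate G {x}) ` carrier G. 1)"
  proof (rule sum.cong[OF refl])
    fix H assume "H \<in> (\<lambda>x. generate G {x}) ` carrier G"
    then obtain x where x: "x \<in> carrier G" and H: "H = generate G {x}"
      by blast
    have "ord y = ord x" if "y \<in> ?C x" for y
      using that x generate_pow_card by simp
    then have "(\<Sum>y\<in>?C x. 1 / real (totient (ord y))) = real (card (?C x)) / real (totient (ord x))"
      by simp
    also have "\<dots> = 1"
      using card_generators_of_cyclic[OF fin x] ord_ge_1[OF fin x] by simp
    finally show "(\<Sum>y\<in>{y \<in> carrier G. generate G {y} = H}. 1 / real (totient (ord y))) = 1"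
      by (simp add: H)
  qed
  finally show ?thesis
    by (simp add: cyclic_subgroups_eq_generate_singletons)
qed

section \<open>The weights in a group of prime power order\<close>

text \<open>
  The right-hand side takes the values \<open>p (p - 1)\<close>, \<open>p\<close> and \<open>1\<close> on elements of order \<open>1\<close>, \<open>p\<close>
  and at least \<open>p\<^sup>2\<close>. Writing it with indicators makes it summable over the group.
\<close>
lemma (in group) scaled_weight_le:
  assumes p: "Factorial_Ring.prime p" and x: "x \<in> carrier G" and ord: "ord x = p ^ k"
  defines "w \<equiv> real p * (real p - 1) / real (totient (ord x))"
    and "b \<equiv> 1 + (if x [^] p = \<one> then real p - 1 else 0)
                + (if x = \<one> then real p * (real p - 2) else 0)"
  shows "w \<le> b" and "w = b \<longleftrightarrow> x [^] (p ^ 2) = \<one>"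
proof -
  have p1: "p > 1"
    using p by (rule prime_gt_1_nat)
  have pow: "x [^] (p ^ m) = \<one> \<longleftrightarrow> k \<le> m" for m
    using p1 unfolding pow_eq_id[OF x] ord by (meson power_dvd_imp_le le_imp_power_dvd)
  have pow1: "x [^] p = \<one> \<longleftrightarrow> k \<le> 1"
    using pow[of 1] by simp
  have one: "x = \<one> \<longleftrightarrow> k = 0"
    using pow[of 0] x by simp
  have "w \<le> b \<and> (w = b \<longleftrightarrow> k \<le> 2)"
  proof -
    consider "k = 0" | "k = 1" | m where "k = Suc (Suc m)"
      by (metis One_nat_def not0_implies_Suc)
    then show ?thesis
    proof cases
      case 1
      then show ?thesis
        using pow1 one ord by (simp add: w_def b_def algebra_simps)
    next
      case 2
      then have "w = real p"
        using p1 totient_prime[OF p] by (simp add: w_def ord of_nat_diff)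
      then show ?thesis
        using 2 pow1 one by (simp add: b_def)
    next
      case 3
      have "real (totient (ord x)) = real p ^ m * (real p * (real p - 1))"
        using 3 p1 totient_prime_power_Suc[OF p, of "Suc m"] by (simp add: ord of_nat_diff)
      then have "w = 1 / real p ^ m"
        using p1 by (simp add: w_def)
      moreover have "b = 1"
        using 3 pow1 one by (simp add: b_def)
      moreover have "real p ^ m = 1 \<longleftrightarrow> m = 0" "real p ^ m \<ge> 1"
        using p1 by (auto dest: power_eq_1_iff)
      ultimately have "w \<le> b \<and> (w = b \<longleftrightarrow> m = 0)"
        using p1 by (auto simp: divide_le_eq_1)
      then show ?thesis
        using 3 by simp
    qed
  qed
  then show "w \<le> b" and "w = b \<longleftrightarrow> x [^] (p ^ 2) = \<one>"
    using pow[of 2] by auto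
qed

lemma (in group) p_group_card_cyclic_subgroups:
  assumes p: "Factorial_Ring.prime p" and ord: "order G = p ^ n"
  defines "L \<equiv> real p * (real p - 1) * real (card (cyclic_subgroups G))"
    and "R \<equiv> real p ^ n + (real p - 1) * real (card (Omega_set p G)) + real p * (real p - 2)"
  shows "L \<le> R" and "L = R \<longleftrightarrow> (\<forall>x\<in>carrier G. x [^] (p ^ 2) = \<one>)"
proof -
  have fin: "finite (carrier G)"
    using ord p by (simp add: order_gt_0_iff_finite[symmetric] prime_gt_0_nat)
  define w where "w x = real p * (real p - 1) / real (totient (group.ord G x))" for x
  define b where "b x = 1 + (if x [^] p = \<one> then real p - 1 else 0)
                + (if x = \<one> then real p * (real p - 2) else 0)" for x
  have "w x \<le> b x \<and> (w x = b x \<longleftrightarrow> x [^] (p ^ 2) = \<one>)" if x: "x \<in> carrier G" for x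
  proof -
    obtain k where "group.ord G x = p ^ k"
      using ord_dvd_group_order[OF x] ord p by (auto simp: divides_primepow_nat)
    then show ?thesis
      unfolding w_def b_def using scaled_weight_le[OF p x] by blast
  qed
  then have le: "\<And>x. x \<in> carrier G \<Longrightarrow> w x \<le> b x"
    and eq: "\<And>x. x \<in> carrier G \<Longrightarrow> w x = b x \<longleftrightarrow> x [^] (p ^ 2) = \<one>"
    by auto
  have L: "L = sum w (carrier G)"
    by (simp add: L_def w_def card_cyclic_subgroups[OF fin] sum_distrib_left)
  have R: "R = sum b (carrier G)"
    using fin ord by (simp add: R_def b_def sum.distrib sum.If_cases Omega_set_def order_def
        Int_def Collect_conj_eq[symmetric] flip: of_nat_power)
  show "L \<le> R"
    unfolding L R by (rule sum_mono[OF le])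
  show "L = R \<longleftrightarrow> (\<forall>x\<in>carrier G. x [^] (p ^ 2) = \<one>)"
  proof
    assume "L = R"
    then show "\<forall>x\<in>carrier G. x [^] (p ^ 2) = \<one>"
      using sum_mono_inv[of w "carrier G" b] le eq fin unfolding L R by blast
  next
    assume "\<forall>x\<in>carrier G. x [^] (p ^ 2) = \<one>"
    then show "L = R"
      unfolding L R using eq by (intro sum.cong) auto
  qed
qed

section \<open>Exponents and proper subgroups\<close>

lemma (in group) pow_group_exponent:
  assumes "finite (carrier G)" and "x \<in> carrier G"
  shows "x [^] group_exponent G = \<one>"
proof -
  have "0 < order G \<and> (\<forall>x\<in>carrier G. x [^] order G = \<one>)"
    using assms pow_order_eq_1 by (simp add: order_gt_0_iff_finite)
  then have "0 < group_exponent G \<and> (\<forall>x\<in>carrier G. x [^] group_exponent G = \<one>)"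
    unfolding group_exponent_def by (rule LeastI)
  then show ?thesis
    using assms by blast
qed

lemma (in group) group_exponent_eq_ordI:
  assumes fin: "finite (carrier G)" and x: "x \<in> carrier G" and m: "ord x = m"
    and pow: "\<And>y. y \<in> carrier G \<Longrightarrow> y [^] m = \<one>"
  shows "group_exponent G = m"
proof -
  have "m dvd group_exponent G"
    using pow_group_exponent[OF fin x] m pow_eq_id[OF x] by simp
  moreover have "m > 0"
    using ord_ge_1[OF fin x] m by simp
  moreover have "group_exponent G \<le> m" and "0 < group_exponent G"
    unfolding group_exponent_def using pow \<open>m > 0\<close> by (auto intro: Least_le LeastI2)
  ultimately show ?thesis
    by (auto dest: dvd_imp_le)
qed

lemma (in group) card_proper_subgroup_p_group:
  assumes p: "Factorial_Ring.prime p" and ord: "order G = p ^ n"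
    and H: "subgroup H G" and proper: "H \<noteq> carrier G"
  shows "card H \<le> p ^ (n - 1)"
proof -
  have fin: "finite (carrier G)"
    using ord p by (simp add: order_gt_0_iff_finite[symmetric] prime_gt_0_nat)
  have "card H dvd p ^ n"
    using lagrange[OF H] ord by (metis dvd_triv_right)
  then obtain k where k: "k \<le> n" "card H = p ^ k"
    using p by (auto simp: divides_primepow_nat)
  have "k \<noteq> n"
    using k ord proper card_subset_eq[OF fin subgroup.subset[OF H]] by (auto simp: order_def)
  then show ?thesis
    using k prime_gt_0_nat[OF p] by (simp add: power_increasing)
qed

text \<open>
  The factor \<open>q - 1\<close> makes the geometric sum telescope. The result is the bound of
  \<open>p_group_card_cyclic_subgroups\<close> with \<open>q ^ (n - 1)\<close> solutions of \<open>x\<^sup>p = 1\<close>.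
\<close>
lemma numerator_closed_form:
  fixes q :: real
  assumes "n \<ge> 3"
  shows "(q * (q - 1)) * (2 * q ^ (n - 2) + (\<Sum>i=1..n-3. q ^ i) + 2)
       = q ^ n + (q - 1) * q ^ (n - 1) + q * (q - 2)"
proof -
  obtain m where m: "n = m + 3"
    using assms by (metis add.commute le_Suc_ex)
  have "(q - 1) * (\<Sum>i=1..m. q ^ i) = q ^ Suc m - q"
    by (induction m) (simp_all add: algebra_simps)
  then have "q * ((q - 1) * (\<Sum>i=1..m. q ^ i)) = q * (q ^ Suc m - q)"
    by simp
  moreover have "n - 2 = Suc m" "n - 3 = m" "n - 1 = Suc (Suc m)" "n = Suc (Suc (Suc m))"
    using m by auto
  ultimately show ?thesis
    by (simp add: algebra_simps)
qed

section \<open>The bound and the case of equality\<close>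

theorem theorem3p1:
  fixes G :: "('a, 'b) monoid_scheme" and p n :: nat
  assumes "Factorial_Ring.prime p" and "odd p" and "n \<ge> 3"
    and "group G" and "order G = p ^ n"
    and "group_exponent G \<noteq> p"
    and "Omega_subgroup p G \<noteq> carrier G"
  shows "alpha G \<le> (2 * real p ^ (n - 2) + (\<Sum>i=1..n-3. real p ^ i) + 2) / real p ^ n
    \<and> (alpha G = (2 * real p ^ (n - 2) + (\<Sum>i=1..n-3. real p ^ i) + 2) / real p ^ n
        \<longleftrightarrow> group_exponent G = p ^ 2
          \<and> Omega_set p G = Omega_subgroup p G
          \<and> subgroup_index G (Omega_subgroup p G) = p)"
proof -
  interpret group G by fact
  note p = assms(1) and ord = assms(5)
  define \<Omega> where "\<Omega> = Omega_subgroup p G"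
  define S where "S = Omega_set p G"
  define B where "B = 2 * real p ^ (n - 2) + (\<Sum>i=1..n-3. real p ^ i) + 2"
  define c where "c = real (card (cyclic_subgroups G))"
  have p1: "p > 1"
    using p by (rule prime_gt_1_nat)
  have n: "n = Suc (n - 1)"
    using assms(3) by simp
  have fin: "finite (carrier G)"
    using ord p1 by (simp add: order_gt_0_iff_finite[symmetric])
  have sub: "subgroup \<Omega> G"
    unfolding \<Omega>_def Omega_subgroup_def by (rule generate_is_subgroup) (auto simp: Omega_set_def)
  have incl: "S \<subseteq> \<Omega>"
    by (auto simp: S_def \<Omega>_def Omega_subgroup_def intro: generate.incl)
  have fin\<Omega>: "finite \<Omega>"
    using subgroup.subset[OF sub] fin finite_subset by blast
  have card\<Omega>: "card \<Omega> \<le> p ^ (n - 1)"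
    using card_proper_subgroup_p_group[OF p ord sub] assms(7) by (simp add: \<Omega>_def)
  have "card S \<le> card \<Omega>"
    using card_mono[OF fin\<Omega> incl] .
  with card\<Omega> have cardS: "card S \<le> p ^ (n - 1)"
    by simp
  then have cardS': "real (card S) \<le> real p ^ (n - 1)"
    by (simp flip: of_nat_power)

  let ?R = "\<lambda>N. real p ^ n + (real p - 1) * N + real p * (real p - 2)"
  have B: "real p * (real p - 1) * B = ?R (real p ^ (n - 1))"
    unfolding B_def by (rule numerator_closed_form[OF assms(3)])
  have c: "real p * (real p - 1) * c \<le> ?R (real (card S))"
    "real p * (real p - 1) * c = ?R (real (card S)) \<longleftrightarrow> (\<forall>x\<in>carrier G. x [^]\<^bsub>G\<^esub> (p ^ 2) = \<one>\<^bsub>G\<^esub>)"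
    unfolding c_def S_def by (rule p_group_card_cyclic_subgroups[OF p ord])+
  have R: "?R (real (card S)) \<le> ?R (real p ^ (n - 1))"
    using cardS' p1 by (simp add: mult_left_mono)
  have R': "?R (real (card S)) = ?R (real p ^ (n - 1)) \<longleftrightarrow> card S = p ^ (n - 1)"
    using p1 by (simp flip: of_nat_power)
  have pos: "real p * (real p - 1) > 0"
    using p1 by simp
  have "real p * (real p - 1) * c \<le> real p * (real p - 1) * B"
    using c(1) R B by linarith
  then have le: "c \<le> B"
    using pos by (simp only: mult_le_cancel_left_pos)
  \<comment> \<open>Both estimates from \<open>c\<close> to \<open>B\<close> must be tight, so the two equality conditions separate.\<close>
  have "c = B \<longleftrightarrow> real p * (real p - 1) * c = real p * (real p - 1) * B"
    using pos by auto
  also have "\<dots> \<longleftrightarrow> real p * (real p - 1) * c = ?R (real (card S)) \<and>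
      ?R (real (card S)) = ?R (real p ^ (n - 1))"
    using c(1) R unfolding B by linarith
  also have "\<dots> \<longleftrightarrow> (\<forall>x\<in>carrier G. x [^]\<^bsub>G\<^esub> (p ^ 2) = \<one>\<^bsub>G\<^esub>) \<and> card S = p ^ (n - 1)"
    unfolding c(2) R' ..
  finally have eq: "c = B \<longleftrightarrow> (\<forall>x\<in>carrier G. x [^]\<^bsub>G\<^esub> (p ^ 2) = \<one>\<^bsub>G\<^esub>) \<and> card S = p ^ (n - 1)" .

  have exp: "(\<forall>x\<in>carrier G. x [^]\<^bsub>G\<^esub> (p ^ 2) = \<one>\<^bsub>G\<^esub>) \<longleftrightarrow> group_exponent G = p ^ 2"
  proof
    assume pow: "\<forall>x\<in>carrier G. x [^]\<^bsub>G\<^esub> (p ^ 2) = \<one>\<^bsub>G\<^esub>"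
    obtain x where x: "x \<in> carrier G" "x \<notin> \<Omega>"
      using subgroup.subset[OF sub] assms(7) by (auto simp: \<Omega>_def)
    then have np: "\<not> group.ord G x dvd p"
      using incl pow_eq_id[OF x(1)] by (auto simp: S_def Omega_set_def)
    have "group.ord G x dvd p ^ 2"
      using pow x(1) pow_eq_id[OF x(1)] by blast
    then obtain k where k: "k \<le> 2" "group.ord G x = p ^ k"
      unfolding divides_primepow_nat[OF p] by blast
    then have "k = 2"
      using np by (cases "k = 0"; cases "k = 1") auto
    then show "group_exponent G = p ^ 2"
      using group_exponent_eq_ordI[OF fin x(1)] k pow by auto
  next
    assume "group_exponent G = p ^ 2"
    then show "\<forall>x\<in>carrier G. x [^]\<^bsub>G\<^esub> (p ^ 2) = \<one>\<^bsub>G\<^esub>"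
      using pow_group_exponent[OF fin] by auto
  qed

  have idx: "card S = p ^ (n - 1) \<longleftrightarrow> S = \<Omega> \<and> subgroup_index G \<Omega> = p"
  proof -
    have "subgroup_index G \<Omega> * card \<Omega> = p * p ^ (n - 1)"
      using lagrange[OF sub] ord n unfolding subgroup_index_def by (metis power_Suc)
    then have "subgroup_index G \<Omega> = p \<longleftrightarrow> card \<Omega> = p ^ (n - 1)"
      using p1 by (metis mult_cancel1 mult_cancel2 not_one_less_zero power_eq_0_iff)
    moreover have "card S = p ^ (n - 1) \<Longrightarrow> S = \<Omega>"
      using card\<Omega> \<open>card S \<le> card \<Omega>\<close> by (intro card_subset_eq[OF fin\<Omega> incl]) simp
    ultimately show ?thesis
      by auto
  qed

  have "alpha G = c / real p ^ n"
    by (simp add: alpha_def c_def ord)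
  moreover have "c / real p ^ n \<le> B / real p ^ n" "c / real p ^ n = B / real p ^ n \<longleftrightarrow> c = B"
    using le p1 by (simp_all add: divide_right_mono)
  ultimately show ?thesis
    unfolding \<Omega>_def[symmetric] S_def[symmetric] B_def[symmetric] using eq exp idx by simp
qed

end
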